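(* Let $\psi=(\psi_\omega,\psi_\lambda)$ be the map defined for $\bm\beta\in\mathbb{R}^k$ and $\bm\delta\in(\mathbb{R}\setminus\{0\})^k$ by $$\bm\omega=\psi_\omega(\bm\beta,\bm\delta)=\mathrm{softmax}(\bm\beta),\qquad \bm\lambda=\psi_\lambda(\bm\beta,\bm\delta)=\bm\delta^2,$$ with the square applied elementwise. The image of $\mathbb{R}^k\times(\mathbb{R}\setminus\{0\})^k$ under $\psi$ is the set of valid Hyper-Erlang distributions (with block sizes $d_1,\dots,d_k$) in the Markovian representation. That is, $\psi$ maps the parametrization $(\bm\beta,\bm\delta)$ onto the set of Hyper-Erlang distributions in the Markovian representation.
   Context: For a vector $\bm v$, $\mathrm{softmax}(\bm v)_i=e^{v_i}/\sum_{j}e^{v_j}$. A Hyper-Erlang distribution of order $n$ with block sizes $d_1,\dots,d_k$, where $n=\sum_i d_i$, is a mixture of $k$ Erlang distributions, the $j$-th having $d_j$ phases with common rate $\lambda_j$ and being chosen with probability $\omega_j$. Its Markovian representation is given by the parameters $(\bm\omega,\bm\lambda)$, $\bm\omega=(\omega_1,\dots,\omega_k)$, $\bm\lambda=(\lambda_1,\dots,\lambda_k)$, where $\lambda_j>0$ and $0\le\omega_j<1$ for all $j\le k$, and $\sum_{j=1}^k\omega_j=1$.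
   Formalization: The weight range 0≤ω_j<1 is replaced by 0<ω_j≤1, since softmax never attains ω_j=0 (e.g. ω=(0,1/2,1/2)) and k=1 forces ω_1=1; for k≥2 the image is shown to be the original set without tuples having a zero weight. *)

theory Defs
  imports "HOL-Analysis.Analysis" "HOL-Probability.Probability"
begin

definition softmax :: "real ^ 'k \<Rightarrow> real ^ 'k" where
  "softmax v = (\<chi> i. exp (v $ i) / (\<Sum>j\<in>UNIV. exp (v $ j)))"

definition psi_omega :: "real ^ 'k \<Rightarrow> real ^ 'k \<Rightarrow> real ^ 'k" where
  "psi_omega \<beta> \<delta> = softmax \<beta>"

definition psi_lambda :: "real ^ 'k \<Rightarrow> real ^ 'k \<Rightarrow> real ^ 'k" where
  "psi_lambda \<beta> \<delta> = (\<chi> j. (\<delta> $ j)\<^sup>2)"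

definition psi :: "(real ^ 'k) \<times> (real ^ 'k) \<Rightarrow> (real ^ 'k) \<times> (real ^ 'k)" where
  "psi = (\<lambda>(\<beta>, \<delta>). (psi_omega \<beta> \<delta>, psi_lambda \<beta> \<delta>))"

definition psi_domain :: "((real ^ 'k) \<times> (real ^ 'k)) set" where
  "psi_domain = UNIV \<times> {\<delta>. \<forall>j. \<delta> $ j \<noteq> 0}"

text \<open>The library's \<^term>\<open>erlang_density m l\<close> has \<^term>\<open>Suc m\<close> phases, so a block with
  \<^term>\<open>d $ j\<close> phases (at least one) has shape index \<^term>\<open>d $ j - 1\<close>.\<close>

definition hyper_erlang :: "nat ^ 'k \<Rightarrow> real ^ 'k \<Rightarrow> real ^ 'k \<Rightarrow> real measure" where
  "hyper_erlang d \<omega> r =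
     density lborel
       (\<lambda>x. ennreal (\<Sum>j\<in>UNIV. \<omega> $ j * erlang_density (d $ j - 1) (r $ j) x))"

text \<open>Markovian parameters with the weight range \<open>0 \<le> \<omega>\<^sub>j < 1\<close>. This range excludes the
  single block (\<open>k = 1\<close> forces \<open>\<omega>\<^sub>1 = 1\<close>), and it admits zero weights, for which the corresponding
  block does not occur in the mixture and which softmax never attains.\<close>

definition markovian_half_open :: "((real ^ 'k) \<times> (real ^ 'k)) set" where
  "markovian_half_open =
     {(\<omega>, r). (\<forall>j. 0 < r $ j) \<and> (\<forall>j. 0 \<le> \<omega> $ j \<and> \<omega> $ j < 1) \<and> (\<Sum>j\<in>UNIV. \<omega> $ j) = 1}"

text \<open>Markovian parameters of a mixture in which each of the \<open>k\<close> blocks occurs: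
  \<open>0 < \<omega>\<^sub>j \<le> 1\<close>, where \<open>\<omega>\<^sub>j = 1\<close> is possible only for \<open>k = 1\<close>.\<close>

definition markovian :: "((real ^ 'k) \<times> (real ^ 'k)) set" where
  "markovian =
     {(\<omega>, r). (\<forall>j. 0 < r $ j) \<and> (\<forall>j. 0 < \<omega> $ j \<and> \<omega> $ j \<le> 1) \<and> (\<Sum>j\<in>UNIV. \<omega> $ j) = 1}"

definition hyper_erlang_distributions :: "nat ^ 'k \<Rightarrow> real measure set" where
  "hyper_erlang_distributions d = {hyper_erlang d \<omega> r | \<omega> r. (\<omega>, r) \<in> markovian}"

end

theory Submission
  imports Defs
begin

text \<open>Softmax of a vector of logarithms is normalisation, so a positive probability vector
  \<open>\<omega>\<close> is the softmax of \<open>ln \<omega>\<close>, and \<open>\<lambda>\<close> is the square of \<open>sqrt \<lambda>\<close>.\<close>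

lemma softmax_denominator_pos:
  fixes v :: "real ^ 'k"
  shows "0 < (\<Sum>j\<in>UNIV. exp (v $ j))"
  by (rule sum_pos) auto

lemma softmax_pos: "0 < softmax v $ i"
  using softmax_denominator_pos[of v] by (simp add: softmax_def)

lemma sum_softmax: "(\<Sum>i\<in>UNIV. softmax v $ i) = 1"
  using softmax_denominator_pos[of v]
  by (simp add: softmax_def flip: sum_divide_distrib)

lemma softmax_ln:
  fixes \<omega> :: "real ^ 'k"
  assumes "\<And>j. 0 < \<omega> $ j" and "(\<Sum>j\<in>UNIV. \<omega> $ j) = 1"
  shows "softmax (\<chi> j. ln (\<omega> $ j)) = \<omega>"
  using assms by (simp add: softmax_def vec_eq_iff)

lemma prob_weight_le_1:
  fixes \<omega> :: "real ^ 'k"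
  assumes "\<And>j. 0 \<le> \<omega> $ j" and "(\<Sum>j\<in>UNIV. \<omega> $ j) = 1"
  shows "\<omega> $ i \<le> 1"
  using member_le_sum[of i UNIV "\<lambda>j. \<omega> $ j"] assms by simp

text \<open>With a second index present, the weights other than \<open>\<omega> $ i\<close> have a
  positive total, which is what \<open>\<omega> $ i\<close> falls short of 1 by. For a single index
  the only weight is 1.\<close>

lemma prob_weight_less_1:
  fixes \<omega> :: "real ^ 'k"
  assumes pos: "\<And>j. 0 < \<omega> $ j" and total: "(\<Sum>j\<in>UNIV. \<omega> $ j) = 1"
    and card: "CARD('k) \<ge> 2"
  shows "\<omega> $ i < 1"
proof -
  \<comment> \<open>Otherwise the index type would have cardinality 1. This makes the remaining
    index set nonempty, as \<open>sum_pos\<close> requires.\<close>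
  have "UNIV \<noteq> {i}"
    using card by (metis card.empty card.insert empty_iff finite.emptyI not_less_eq_eq
        numeral_2_eq_2 order_refl)
  then have "0 < (\<Sum>j\<in>UNIV - {i}. \<omega> $ j)"
    by (intro sum_pos pos) auto
  then show ?thesis
    using total by (simp add: sum.remove[of UNIV i])
qed

lemma psi_image: "psi ` psi_domain = (markovian :: ((real ^ 'k) \<times> (real ^ 'k)) set)"
proof
  show "psi ` psi_domain \<subseteq> (markovian :: ((real ^ 'k) \<times> (real ^ 'k)) set)"
    \<comment> \<open>Squares of nonzero reals are positive. The non-strict bound on the weights
      covers the single block too, where softmax is constantly 1.\<close>
    by (auto simp: psi_def psi_omega_def psi_lambda_def psi_domain_def markovian_def
        softmax_pos sum_softmax prob_weight_le_1 less_imp_le)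
next
  show "(markovian :: ((real ^ 'k) \<times> (real ^ 'k)) set) \<subseteq> psi ` psi_domain"
  proof
    fix p :: "(real ^ 'k) \<times> (real ^ 'k)"
    assume "p \<in> markovian"
    then obtain \<omega> r where p: "p = (\<omega>, r)" and r: "\<And>j. 0 < r $ j"
      and \<omega>: "\<And>j. 0 < \<omega> $ j" "(\<Sum>j\<in>UNIV. \<omega> $ j) = 1"
      by (auto simp: markovian_def)
    let ?q = "(\<chi> j. ln (\<omega> $ j), \<chi> j. sqrt (r $ j))"
    have "?q \<in> psi_domain"
      using r by (simp add: psi_domain_def less_imp_neq[symmetric])
    moreover have "psi ?q = p"
      using r by (simp add: p psi_def psi_omega_def psi_lambda_def softmax_ln[OF \<omega>]
          vec_eq_iff less_imp_le)
    ultimately show "p \<in> psi ` psi_domain"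
      by (metis image_eqI)
  qed
qed

text \<open>With at least two blocks, positive weights of total 1 are automatically below 1, so only
  zero weights can separate the two parameter sets.\<close>

lemma markovian_eq_half_open:
  assumes "CARD('k) \<ge> 2"
  shows "(markovian :: ((real ^ 'k) \<times> (real ^ 'k)) set) =
    {(\<omega>, r) \<in> markovian_half_open. \<forall>j. \<omega> $ j \<noteq> 0}"
proof -
  \<comment> \<open>Both sets share the conditions on the rates and on the total, so it suffices to
    compare the weight ranges for a fixed total of 1.\<close>
  have "(\<forall>j. 0 < \<omega> $ j \<and> \<omega> $ j \<le> 1) \<longleftrightarrow>
      (\<forall>j. 0 \<le> \<omega> $ j \<and> \<omega> $ j < 1) \<and> (\<forall>j. \<omega> $ j \<noteq> 0)"
    if "(\<Sum>j\<in>UNIV. \<omega> $ j) = 1" for \<omega> :: "real ^ 'k"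
  proof -
    have "\<omega> $ i < 1" if "\<forall>j. 0 < \<omega> $ j" for i
      using that \<open>(\<Sum>j\<in>UNIV. \<omega> $ j) = 1\<close> assms by (intro prob_weight_less_1) auto
    then show ?thesis
      by (metis less_eq_real_def less_irrefl)
  qed
  then show ?thesis
    by (auto simp only: markovian_def markovian_half_open_def mem_Collect_eq case_prod_conv)
qed

text \<open>Softmax weights are positive, and equal to 1 for a single block; hence the image is
  compared with \<open>markovian_half_open\<close> only for two or more blocks and after discarding
  zero weights. The hypothesis on \<open>d\<close> makes the truncated subtraction
  \<open>d $ j - 1\<close> exact, so each block has \<open>d $ j\<close> phases.\<close>

theorem proposition3:
  fixes d :: "nat ^ 'k"
  assumes "\<forall>j. 1 \<le> d $ j"
  shows "psi ` psi_domain = (markovian :: ((real ^ 'k) \<times> (real ^ 'k)) set)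
    \<and> (CARD('k) \<ge> 2 \<longrightarrow>
         psi ` psi_domain =
           {(\<omega>, r) \<in> (markovian_half_open :: ((real ^ 'k) \<times> (real ^ 'k)) set). \<forall>j. \<omega> $ j \<noteq> 0})
    \<and> (\<lambda>(\<beta>, \<delta>). hyper_erlang d (psi_omega \<beta> \<delta>) (psi_lambda \<beta> \<delta>)) ` psi_domain
        = hyper_erlang_distributions d"
proof (intro conjI impI)
  show "psi ` psi_domain = (markovian :: ((real ^ 'k) \<times> (real ^ 'k)) set)"
    by (rule psi_image)
next
  assume "CARD('k) \<ge> 2"
  then show "psi ` psi_domain =
      {(\<omega>, r) \<in> (markovian_half_open :: ((real ^ 'k) \<times> (real ^ 'k)) set). \<forall>j. \<omega> $ j \<noteq> 0}"
    by (simp only: psi_image markovian_eq_half_open)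
next
  \<comment> \<open>The distribution depends on \<open>(\<beta>, \<delta>)\<close> only through
    \<open>psi\<close>, so surjectivity onto distributions is inherited from surjectivity onto
    parameters.\<close>
  have "(\<lambda>(\<beta>, \<delta>). hyper_erlang d (psi_omega \<beta> \<delta>) (psi_lambda \<beta> \<delta>)) ` psi_domain
      = (\<lambda>(\<omega>, r). hyper_erlang d \<omega> r) ` psi ` psi_domain"
    by (simp add: image_image psi_def case_prod_unfold)
  also have "\<dots> = hyper_erlang_distributions d"
    by (auto simp: psi_image hyper_erlang_distributions_def)
  finally show "(\<lambda>(\<beta>, \<delta>). hyper_erlang d (psi_omega \<beta> \<delta>) (psi_lambda \<beta> \<delta>)) ` psi_domain
      = hyper_erlang_distributions d" .
qed

end
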